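(* For any integer $k\ge 3$, there exist $\epsilon>0$ and an integer $n_1$ such that the following holds. Let $n\ge n_1$ be an integer not divisible by $k$ and let $H$ be an $n$-vertex $k$-uniform hypergraph with $\delta_{k-1}(H)\ge\lfloor n/k\rfloor$. If $H$ is $\epsilon$-extremal, then $H$ contains a matching of size $\lfloor n/k\rfloor$ (a near perfect matching).
   Context: A $k$-uniform hypergraph $H$ has vertex set $V(H)$ and edge set $E(H)\subseteq\binom{V(H)}{k}$. A matching is a collection of pairwise vertex-disjoint edges. $\delta_{k-1}(H)$ is the minimum, over all $(k-1)$-sets $S$ of vertices, of the number of edges containing $S$. A set of vertices is independent if it contains no edge of $H$. For $\beta>0$, an $n$-vertex $k$-graph $H$ is $\beta$-extremal if $V(H)$ contains an independent set of size at least $(1-\beta)\frac{k-1}{k}n$. *)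

theory Defs
  imports Complex_Main
begin

text \<open>A \<open>k\<close>-uniform hypergraph is a finite vertex set \<open>V\<close> together with a set \<open>E\<close> of
  \<open>k\<close>-subsets of \<open>V\<close>.\<close>

definition uniform_hypergraph :: "nat \<Rightarrow> 'a set \<Rightarrow> 'a set set \<Rightarrow> bool" where
  "uniform_hypergraph k V E \<longleftrightarrow> finite V \<and> E \<subseteq> {e. e \<subseteq> V \<and> card e = k}"

definition matching :: "'a set set \<Rightarrow> 'a set set \<Rightarrow> bool" where
  "matching E M \<longleftrightarrow> M \<subseteq> E \<and> pairwise disjnt M"

definition set_degree :: "'a set set \<Rightarrow> 'a set \<Rightarrow> nat" where
  "set_degree E S = card {e \<in> E. S \<subseteq> e}"

text \<open>\<open>min_degree d V E\<close> is \<open>\<delta>\<^sub>d\<close>. The minimum is taken over a nonempty family only when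
  \<open>d \<le> card V\<close>; below that its value is unspecified.\<close>

definition min_degree :: "nat \<Rightarrow> 'a set \<Rightarrow> 'a set set \<Rightarrow> nat" where
  "min_degree d V E = Min (set_degree E ` {S. S \<subseteq> V \<and> card S = d})"

definition independent_set :: "'a set \<Rightarrow> 'a set set \<Rightarrow> 'a set \<Rightarrow> bool" where
  "independent_set V E A \<longleftrightarrow> A \<subseteq> V \<and> (\<forall>e\<in>E. \<not> e \<subseteq> A)"

definition extremal :: "nat \<Rightarrow> real \<Rightarrow> 'a set \<Rightarrow> 'a set set \<Rightarrow> bool" where
  "extremal k \<beta> V E \<longleftrightarrow>
     (\<exists>A. independent_set V E A \<and>
          real (card A) \<ge> (1 - \<beta>) * ((real k - 1) / real k) * real (card V))"

end

theory Submission
  imports Defs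
begin

text \<open>Write \<open>n = m k + r\<close> with \<open>0 < r < k\<close> and let \<open>A\<close> be the large independent set. A
  \<open>(k - 1)\<close>-subset of \<open>A\<close> extends to an edge only by vertices outside \<open>A\<close>, of which there are
  \<open>m + s\<close> with \<open>s\<close> much smaller than \<open>m\<close>, and at least \<open>m\<close> of them do extend it. So for most
  vertices \<open>c\<close> outside \<open>A\<close> the link of \<open>c\<close> in \<open>A\<close> has no small vertex cover; let \<open>C\<close> be the
  set of these. All but \<open>2 s\<close> vertices outside \<open>A\<close> lie in \<open>C\<close>, so there is a matching of
  \<open>m - 2 s\<close> generic edges, i.e. edges with one vertex in \<open>C\<close> and \<open>k - 1\<close> in \<open>A\<close>. It is
  enlarged one edge at a time, each step changing a bounded number of edges, so that almost all
  edges stay generic.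

  An uncovered \<open>c \<in> C\<close> together with \<open>k - 1\<close> uncovered vertices of \<open>A\<close> can always be absorbed by
  recombining a few generic edges. Because \<open>r \<ge> 1\<close>, at least \<open>k + 1\<close> vertices are uncovered, and
  this spare vertex makes it possible to absorb any \<open>k + 1\<close> uncovered vertices among which is a
  vertex of \<open>C\<close>: an uncovered \<open>(k - 1)\<close>-set has at least \<open>m\<close> neighbours, so it can be traded for
  \<open>k - 1\<close> vertices of a generic edge. If \<open>C\<close> is covered, then either an edge of the matching
  contains two vertices of \<open>C\<close> and is dissolved, or fewer than \<open>m - |C|\<close> edges of the matching
  miss \<open>C\<close>, and an edge avoiding \<open>C\<close> is gained, releasing vertices of \<open>C\<close>.\<close>

section \<open>Counting with disjoint families\<close>

lemma card_le_if_disjoint_hits: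
  assumes "pairwise disjnt F" "\<And>e. e \<in> F \<Longrightarrow> e \<inter> X \<noteq> {}" "finite X"
  shows "card F \<le> card X"
proof -
  have "\<forall>e\<in>F. \<exists>x. x \<in> e \<inter> X" using assms(2) by blast
  then obtain f where f: "\<forall>e\<in>F. f e \<in> e \<inter> X" by metis
  have "inj_on f F"
  proof (rule inj_onI)
    fix e e' assume "e \<in> F" "e' \<in> F" "f e = f e'"
    with f have "\<not> disjnt e e'" by (metis IntD1 disjnt_iff)
    with \<open>e \<in> F\<close> \<open>e' \<in> F\<close> assms(1) show "e = e'" by (auto simp: pairwise_def)
  qed
  moreover have "f ` F \<subseteq> X" using f by blast
  ultimately show ?thesis using assms(3) by (rule card_inj_on_le)
qed

lemma disjoint_subset_Un: "U' \<subseteq> U \<union> W \<Longrightarrow> Q \<inter> U = {} \<Longrightarrow> Q \<inter> W = {} \<Longrightarrow> Q \<inter> U' = {}"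
  by blast

lemma disjoint_subsets_exist:
  assumes "finite A" "0 < q" "q * t \<le> card A"
  shows "\<exists>F. card F = t \<and> finite F \<and> pairwise disjnt F \<and> (\<forall>S\<in>F. S \<subseteq> A \<and> card S = q)"
  using assms(3)
proof (induction t)
  case 0
  show ?case by (rule exI[of _ "{}"]) auto
next
  case (Suc t)
  then obtain F where F: "card F = t" "finite F" "pairwise disjnt F" "\<forall>S\<in>F. S \<subseteq> A \<and> card S = q"
    by auto
  have "card (\<Union>F) \<le> (\<Sum>S\<in>F. card S)" by (rule card_Union_le_sum_card)
  also have "\<dots> = q * t" using F by simp
  finally have "q \<le> card (A - \<Union>F)"
    using Suc.prems diff_card_le_card_Diff[of "\<Union>F" A] F assms(1)
    by (metis (no_types, lifting) Sup_le_iff add_le_imp_le_diff diff_le_mono2 finite_subset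
        le_trans mult_Suc_right)
  then obtain S where S: "S \<subseteq> A - \<Union>F" "card S = q" by (meson obtain_subset_with_card_n)
  have "S \<noteq> {}" using S assms(2) by auto
  then have "S \<notin> F" using S(1) by blast
  have "\<forall>T\<in>F. disjnt S T" using S(1) by (auto simp: disjnt_iff)
  then have "pairwise disjnt (insert S F)" using F(3) by (auto simp: pairwise_insert disjnt_sym)
  then show ?case using F S \<open>S \<notin> F\<close> by (intro exI[of _ "insert S F"]) auto
qed

lemma distinct_representatives_greedy:
  assumes "finite F" "\<And>S. S \<in> F \<Longrightarrow> card F \<le> card (N S)"
  shows "\<exists>f. inj_on f F \<and> (\<forall>S\<in>F. f S \<in> N S)"
  using assms
proof (induction F)
  case empty
  show ?case by simp
next
  case (insert S F)
  then obtain f where f: "inj_on f F" "\<forall>S\<in>F. f S \<in> N S" by fastforce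
  have "card (f ` F) < card (N S)"
    using card_image_le[OF \<open>finite F\<close>, of f] insert.prems[of S] insert.hyps by simp
  then have "\<not> N S \<subseteq> f ` F" using \<open>finite F\<close> by (meson card_mono finite_imageI not_le)
  then obtain x where x: "x \<in> N S" "x \<notin> f ` F" by blast
  have "inj_on (f(S := x)) (insert S F)"
    using f(1) x(2) insert.hyps by (auto simp: inj_on_def)
  moreover have "\<forall>T\<in>insert S F. (f(S := x)) T \<in> N T" using f(2) x(1) insert.hyps by auto
  ultimately show ?case by blast
qed

text \<open>Double counting of the pairs outside \<open>R\<close>. When each element of
  \<open>Q'\<close> misses at least half of \<open>P\<close>, \<open>half_cancel\<close> then leaves
  at most \<open>2 * s\<close> such elements.\<close>

lemma missing_pairs_bound:
  assumes "finite P" "finite Q" "Q' \<subseteq> Q"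
    and "\<And>x. x \<in> P \<Longrightarrow> card {y \<in> Q. \<not> R x y} \<le> s"
    and "\<And>y. y \<in> Q' \<Longrightarrow> h \<le> card {x \<in> P. \<not> R x y}"
  shows "card Q' * h \<le> card P * s"
proof -
  have fin: "finite Q'" using assms(2,3) by (rule finite_subset[rotated])
  have "card Q' * h \<le> (\<Sum>y\<in>Q'. card {x \<in> P. \<not> R x y})"
    using sum_bounded_below[of Q' h "\<lambda>y. card {x \<in> P. \<not> R x y}"] assms(5) by simp
  also have "\<dots> = (\<Sum>x\<in>P. card {y \<in> Q'. \<not> R x y})"
    using sum_multicount_gen[of Q' P "\<lambda>y x. \<not> R x y" "\<lambda>x. card {y \<in> Q'. \<not> R x y}"] fin assms(1)
    by simp
  also have "\<dots> \<le> (\<Sum>x\<in>P. s)"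
  proof (rule sum_mono)
    fix x assume "x \<in> P"
    have "card {y \<in> Q'. \<not> R x y} \<le> card {y \<in> Q. \<not> R x y}"
      using assms(2,3) by (intro card_mono) auto
    with assms(4)[OF \<open>x \<in> P\<close>] show "card {y \<in> Q'. \<not> R x y} \<le> s" by linarith
  qed
  finally show ?thesis by simp
qed

lemma half_cancel:
  fixes g h s x :: nat
  assumes "x * h \<le> g * s" "g \<le> 2 * h" "0 < g"
  shows "x \<le> 2 * s"
proof -
  have "g * x \<le> x * (2 * h)" unfolding mult.commute[of g] using assms(2) by (rule mult_le_mono2)
  also have "\<dots> = 2 * (x * h)" by simp
  also have "\<dots> \<le> 2 * (g * s)" using assms(1) by (rule mult_le_mono2)
  also have "\<dots> = g * (2 * s)" by simp
  finally show ?thesis using assms(3) nat_mult_le_cancel1 by blast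
qed

section \<open>The extremal setting and its generic edges\<close>

text \<open>\<open>s\<close> is the excess of \<open>V - A\<close> over \<open>m\<close>, and
  \<open>d\<close> is how many generic edges a matching may lack. \<open>card_V\<close> makes
  \<open>m\<close> the quotient of \<open>card V\<close> by \<open>k\<close>, with a positive
  remainder.\<close>

locale extremal_hypergraph =
  fixes k m s d :: nat and V A :: "'a set" and E :: "'a set set"
  assumes k3: "3 \<le> k"
    and finV: "finite V"
    and edge: "\<And>e. e \<in> E \<Longrightarrow> e \<subseteq> V \<and> card e = k"
    and AV: "A \<subseteq> V"
    and indep: "\<And>e. e \<in> E \<Longrightarrow> \<not> e \<subseteq> A"
    and codegree: "\<And>S. S \<subseteq> V \<Longrightarrow> card S = k - 1 \<Longrightarrow> m \<le> card {v \<in> V. v \<notin> S \<and> insert v S \<in> E}"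
    and card_V: "k * m < card V" "card V < k * m + k"
    and card_B: "card (V - A) = m + s"
    and large: "6 * k * (d + 2 * s + 1) \<le> m"
begin

definition nbr :: "'a set \<Rightarrow> 'a set" where
  "nbr S = {v \<in> V. v \<notin> S \<and> insert v S \<in> E}"

text \<open>The condition says that \<open>c\<close> is adjacent to some \<open>(k - 1)\<close>-subset of \<open>A\<close> avoiding any small
  set \<open>Z\<close>; it is applied with \<open>Z\<close> the complement of the well-behaved generic edges.\<close>

definition C :: "'a set" where
  "C = {c \<in> V - A. \<forall>Z. Z \<subseteq> V \<longrightarrow> card Z \<le> k * (d + 2 * s + 1) \<longrightarrow>
     (\<exists>X. X \<subseteq> A - Z \<and> card X = k - 1 \<and> insert c X \<in> E)}"

definition gen :: "'a set set \<Rightarrow> 'a set set" where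
  "gen M = {e \<in> M. \<exists>c S. c \<in> C \<and> S \<subseteq> A \<and> card S = k - 1 \<and> e = insert c S}"

definition links :: "'a set set \<Rightarrow> 'a \<Rightarrow> 'a set set" where
  "links M c = {e \<in> gen M. insert c (e \<inter> A) \<in> E}"

text \<open>A vertex that is not poor keeps more than \<open>s\<close> links, as
  \<open>augment_linked\<close> asks, even after \<open>2 * k\<close> edges have changed.\<close>

definition poor :: "'a set set \<Rightarrow> 'a set" where
  "poor M = {c \<in> C. card (links M c) < s + 2 * k + 1}"

text \<open>In order, these serve \<open>extend_into_gen\<close>, \<open>card_not_C\<close>,
  \<open>card_poor\<close>, the pigeonhole step of \<open>matching_enlargeable\<close>, and the
  subtractions \<open>m - s\<close> and \<open>m - 2 * s\<close>.\<close>

lemma large_consequences: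
  "k * d + k < m" "2 * (k * (d + 2 * s + 1)) + s \<le> m" "2 * (s + 2 * k + 1) + d \<le> m"
  "2 * d < m" "2 * s \<le> m"
proof -
  define x where "x = k * d"
  define y where "y = k * s"
  have le: "3 * d \<le> x" "3 * s \<le> y" using k3 by (auto simp: x_def y_def)
  have eq: "6 * k * (d + 2 * s + 1) = 6 * x + 12 * y + 6 * k" "k * (d + 2 * s + 1) = x + 2 * y + k"
    by (simp_all add: x_def y_def algebra_simps)
  have m: "6 * x + 12 * y + 6 * k \<le> m" using large eq(1) by linarith
  show "k * d + k < m" using m k3 by (simp add: x_def)
  show "2 * (k * (d + 2 * s + 1)) + s \<le> m" unfolding eq(2) using m le by (simp add: distrib_left)
  show "2 * (s + 2 * k + 1) + d \<le> m" using m le k3 by (simp add: distrib_left)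
  show "2 * d < m" using m le k3 by linarith
  show "2 * s \<le> m" using m le by linarith
qed

section \<open>Matchings and exchanges of edges\<close>

lemma finE: "finite E"
  using finite_subset[of E "Pow V"] edge finV by auto

lemma edge_nonempty: "e \<in> E \<Longrightarrow> e \<noteq> {}"
  using edge k3 by force

lemma edge_finite: "e \<in> E \<Longrightarrow> finite e"
  using edge finV finite_subset by blast

lemma finite_matching: "matching E M \<Longrightarrow> finite M"
  using finE finite_subset by (auto simp: matching_def)

lemma matching_Union_subset: "matching E M \<Longrightarrow> \<Union>M \<subseteq> V"
  using edge by (fastforce simp: matching_def)

lemma matching_disjoint: "matching E M \<Longrightarrow> e \<in> M \<Longrightarrow> f \<in> M \<Longrightarrow> x \<in> e \<Longrightarrow> x \<in> f \<Longrightarrow> e = f"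
  by (auto simp: matching_def pairwise_def disjnt_iff)

lemma card_Union_matching:
  assumes "matching E M"
  shows "card (\<Union>M) = k * card M"
proof -
  have "card (\<Union>M) = sum card M"
    using assms edge_finite by (intro card_Union_disjoint) (auto simp: matching_def)
  also have "\<dots> = (\<Sum>e\<in>M. k)" using assms edge by (intro sum.cong) (auto simp: matching_def)
  finally show ?thesis by simp
qed

lemma matching_subset: "matching E M \<Longrightarrow> M' \<subseteq> M \<Longrightarrow> matching E M'"
  by (meson matching_def order_trans pairwise_subset)

text \<open>\<open>N\<close> may use only uncovered vertices and those released by \<open>R\<close>.
  Sizes are compared as sums, which avoids truncated subtraction.\<close>

lemma matching_exchange:
  assumes "matching E M" "R \<subseteq> M" "matching E N" "\<Union>N \<inter> \<Union>(M - R) = {}"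
  shows "matching E ((M - R) \<union> N)" "card ((M - R) \<union> N) + card R = card M + card N"
    "card (M - ((M - R) \<union> N)) \<le> card R"
proof -
  show "matching E ((M - R) \<union> N)"
    unfolding matching_def
  proof
    show "M - R \<union> N \<subseteq> E" using assms by (auto simp: matching_def)
    show "pairwise disjnt (M - R \<union> N)"
    proof (rule pairwiseI)
      fix x y assume "x \<in> M - R \<union> N" "y \<in> M - R \<union> N" "x \<noteq> y"
      moreover have "disjnt u v" if "u \<in> M - R" "v \<in> N" for u v
        using that assms(4) by (force simp: disjnt_def)
      ultimately show "disjnt x y"
        using assms(1,3) by (auto simp: matching_def pairwise_def disjnt_sym)
    qed
  qed
  have fin: "finite M" "finite N" "finite R"
    using assms finite_matching finite_subset by blast+
  have "e = {}" if "e \<in> (M - R) \<inter> N" for e using that assms(4) by blast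
  then have "(M - R) \<inter> N = {}" using assms(3) edge_nonempty by (force simp: matching_def)
  then have "card ((M - R) \<union> N) = card (M - R) + card N" using fin by (simp add: card_Un_disjoint)
  moreover have "card (M - R) + card R = card M"
    using fin assms(2) by (metis card_Diff_subset card_mono le_add_diff_inverse2)
  ultimately show "card ((M - R) \<union> N) + card R = card M + card N" by simp
  show "card (M - ((M - R) \<union> N)) \<le> card R" using fin by (intro card_mono) auto
qed

lemma C_subset: "C \<subseteq> V - A"
  by (auto simp: C_def)

lemma finite_A: "finite A"
  using AV finV finite_subset by blast

lemma gen_subset: "gen M \<subseteq> M"
  by (auto simp: gen_def)

lemma genE:
  assumes "e \<in> gen M"
  obtains c S where "e \<in> M" "c \<in> C" "c \<notin> A" "S \<subseteq> A" "card S = k - 1" "e = insert c S"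
    "e \<inter> A = S" "e - A = {c}" "c \<notin> S"
proof -
  obtain c S where "e \<in> M" "c \<in> C" "S \<subseteq> A" "card S = k - 1" "e = insert c S"
    using assms by (auto simp: gen_def)
  moreover from this C_subset have "c \<notin> A" by auto
  ultimately show thesis by (intro that[of c S]) auto
qed

text \<open>Independence of \<open>A\<close> forces the neighbours of \<open>S\<close>, at least
  \<open>m\<close> of them, into \<open>V - A\<close>, which has only \<open>m + s\<close>
  vertices.\<close>

lemma card_missing_C:
  assumes "S \<subseteq> A" "card S = k - 1"
  shows "card {y \<in> V - A. insert y S \<notin> E} \<le> s"
proof -
  have sub: "nbr S \<subseteq> V - A" using assms indep by (auto simp: nbr_def)
  have "{y \<in> V - A. insert y S \<notin> E} = (V - A) - nbr S" using assms by (auto simp: nbr_def)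
  then have "card {y \<in> V - A. insert y S \<notin> E} = (m + s) - card (nbr S)"
    using sub finV card_B by (metis card_Diff_subset finite_Diff finite_subset)
  moreover have "m \<le> card (nbr S)" using codegree[of S] assms AV by (simp add: nbr_def)
  ultimately show ?thesis by simp
qed

lemma card_gen_change:
  assumes "finite M" "finite M'"
  shows "card (gen M) \<le> card (gen M') + card (M - M')"
proof -
  have "gen M \<subseteq> gen M' \<union> (M - M')" by (auto simp: gen_def)
  moreover have "finite (gen M' \<union> (M - M'))" using assms gen_subset[of M'] by (auto intro: finite_subset)
  ultimately have "card (gen M) \<le> card (gen M' \<union> (M - M'))" by (rule card_mono[rotated])
  then show ?thesis using card_Un_le[of "gen M'" "M - M'"] by linarith
qed

section \<open>Absorbing a vertex of \<open>C\<close> with \<open>k - 1\<close> vertices of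
  \<open>A\<close>\<close>

text \<open>\<open>W\<close> limits the newly covered vertices, so that others stay free for later
  steps; \<open>l\<close> limits the edges given up, so that most generic edges survive.\<close>

definition near :: "'a set set \<Rightarrow> 'a set \<Rightarrow> nat \<Rightarrow> nat \<Rightarrow> 'a set set \<Rightarrow> bool" where
  "near M W q l M' \<longleftrightarrow> matching E M' \<and> card M' = card M + q \<and> \<Union>M' \<subseteq> \<Union>M \<union> W \<and> card (M - M') \<le> l"

lemma near_trans:
  assumes "near M W q l M'" "near M' W' q' l' M''" "matching E M"
  shows "near M (W \<union> W') (q + q') (l + l') M''"
proof -
  have "card (M - M'') \<le> card ((M - M') \<union> (M' - M''))"
    using assms finite_matching by (intro card_mono) (auto simp: near_def)
  also have "\<dots> \<le> l + l'"
    using card_Un_le[of "M - M'" "M' - M''"] assms by (auto simp: near_def)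
  finally have "card (M - M'') \<le> l + l'" .
  moreover have "\<Union>M'' \<subseteq> \<Union>M \<union> (W \<union> W')" using assms unfolding near_def by blast
  ultimately show ?thesis using assms by (auto simp: near_def)
qed

lemma near_gen:
  assumes "near M W q l M'" "matching E M"
  shows "card (gen M) \<le> card (gen M') + l"
  using card_gen_change[of M M'] assms finite_matching by (force simp: near_def)

lemma matching_pair:
  assumes "e \<in> E" "f \<in> E" "e \<inter> f = {}"
  shows "matching E {e, f}" "card {e, f} = 2"
proof -
  show "matching E {e, f}"
    using assms by (auto simp: matching_def pairwise_insert disjnt_def)
  have "e \<noteq> f" using assms edge_nonempty by blast
  then show "card {e, f} = 2" by simp
qed

lemma matching_single: "e \<in> E \<Longrightarrow> matching E {e}"
  by (auto simp: matching_def)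

text \<open>At most \<open>s\<close> vertices outside \<open>A\<close> fail to extend
  \<open>S\<close>, so among more than \<open>s\<close> disjoint links some
  \<open>e = insert b T\<close> has \<open>insert b S\<close> in \<open>E\<close>. Then
  \<open>c\<close> takes over \<open>T\<close> and \<open>b\<close> takes \<open>S\<close>.\<close>

lemma augment_linked:
  assumes M: "matching E M" and c: "c \<in> C" "c \<notin> \<Union>M"
    and S: "S \<subseteq> A" "card S = k - 1" "S \<inter> \<Union>M = {}"
    and links: "s < card (links M c)"
  shows "\<exists>M'. near M (insert c S) 1 1 M'"
proof -
  let ?X = "{y \<in> V - A. insert y S \<notin> E}"
  have "\<exists>e\<in>links M c. e \<inter> ?X = {}"
  proof (rule ccontr)
    assume "\<not> ?thesis"
    moreover have "pairwise disjnt (links M c)"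
      using M by (rule_tac pairwise_subset[of _ M]) (auto simp: matching_def links_def gen_def)
    ultimately have "card (links M c) \<le> card ?X"
      using finV by (intro card_le_if_disjoint_hits) auto
    with card_missing_C[OF S(1,2)] links show False by simp
  qed
  then obtain e where e: "e \<in> gen M" "insert c (e \<inter> A) \<in> E" "e \<inter> ?X = {}"
    by (auto simp: links_def)
  from e(1) obtain b T where b: "e \<in> M" "b \<in> C" "b \<notin> A" "T \<subseteq> A" "e = insert b T" "e \<inter> A = T"
    by (rule genE)
  have bS: "insert b S \<in> E" using e(3) b C_subset by blast
  have cA: "c \<notin> A" using c C_subset by auto
  have disj: "insert c T \<inter> insert b S = {}"
    using b S c cA by blast
  let ?N = "{insert c T, insert b S}"
  have N: "matching E ?N" "card ?N = 2" using matching_pair disj bS e(2) b by auto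
  have "\<Union>?N \<inter> \<Union>(M - {e}) = {}"
    using c S b matching_disjoint[OF M] by blast
  note ex = matching_exchange[OF M _ N(1) this]
  have "near M (insert c S) 1 1 ((M - {e}) \<union> ?N)"
    unfolding near_def using ex N b by auto
  then show ?thesis by blast
qed

lemma links_change:
  assumes "finite M" "finite M'"
  shows "card (links M c) \<le> card (links M' c) + card (M - M')"
proof -
  have "links M c \<subseteq> links M' c \<union> (M - M')" by (auto simp: links_def gen_def)
  moreover have "finite (links M' c \<union> (M - M'))"
    using assms gen_subset[of M'] by (auto simp: links_def intro: finite_subset)
  ultimately have "card (links M c) \<le> card (links M' c \<union> (M - M'))" by (rule card_mono[rotated])
  then show ?thesis using card_Un_le[of "links M' c" "M - M'"] by linarith
qed

text \<open>Each absorption changes at most one edge and so costs every remaining vertex of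
  \<open>Q\<close> at most one link; the surplus \<open>card Q\<close> pays for this.\<close>

lemma augment_all_linked:
  assumes "finite Q" "matching E M" "Q \<subseteq> C" "Q \<inter> \<Union>M = {}" "R \<subseteq> A" "R \<inter> \<Union>M = {}"
    "card R = (k - 1) * card Q" "\<And>c. c \<in> Q \<Longrightarrow> s + card Q < card (links M c)"
  shows "\<exists>M'. near M (Q \<union> R) (card Q) (card Q) M'"
  using assms
proof (induction Q arbitrary: M R)
  case empty
  then have "near M ({} \<union> R) (card {}) (card {}) M" by (auto simp: near_def)
  then show ?case by blast
next
  case (insert c Q)
  note M = insert.prems(1) and QC = insert.prems(2) and QM = insert.prems(3)
    and RA = insert.prems(4) and RM = insert.prems(5) and cardR = insert.prems(6)
  have finR: "finite R" using finite_subset[OF RA finite_A] .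
  have "k - 1 \<le> card R" using cardR insert.hyps by simp
  then obtain S where S: "S \<subseteq> R" "card S = k - 1" by (meson obtain_subset_with_card_n)
  have "\<exists>M'. near M (insert c S) 1 1 M'"
  proof (rule augment_linked[OF M])
    show "s < card (links M c)" using insert.prems(7)[of c] by simp
  qed (use S QC QM RA RM in auto)
  then obtain M1 where M1: "near M (insert c S) 1 1 M1" by blast
  have "\<exists>M'. near M1 (Q \<union> (R - S)) (card Q) (card Q) M'"
  proof (rule insert.IH)
    show "matching E M1" using M1 by (simp add: near_def)
    have sub: "\<Union>M1 \<subseteq> \<Union>M \<union> insert c S" using M1 by (simp add: near_def)
    have "insert c Q \<inter> A = {}" using QC C_subset by auto
    then have Q: "Q \<inter> insert c S = {}" and R: "(R - S) \<inter> insert c S = {}"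
      using S RA insert.hyps(2) by auto
    have "Q \<inter> \<Union>M = {}" "(R - S) \<inter> \<Union>M = {}" using QM RM by blast+
    then show "Q \<inter> \<Union>M1 = {}" "(R - S) \<inter> \<Union>M1 = {}"
      using disjoint_subset_Un[OF sub _ Q] disjoint_subset_Un[OF sub _ R] by blast+
    show "card (R - S) = (k - 1) * card Q"
      using S finR cardR insert.hyps by (simp add: card_Diff_subset finite_subset)
    show "Q \<subseteq> C" "R - S \<subseteq> A" using QC RA by auto
    fix b assume "b \<in> Q"
    then have "s + card (insert c Q) < card (links M b)" by (intro insert.prems(7)) simp
    moreover have "card (links M b) \<le> card (links M1 b) + 1"
      using links_change[of M M1 b] M1 M finite_matching unfolding near_def by fastforce
    ultimately show "s + card Q < card (links M1 b)" using insert.hyps by simp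
  qed
  then obtain M2 where "near M1 (Q \<union> (R - S)) (card Q) (card Q) M2" by blast
  from near_trans[OF M1 this M] insert.hyps
  have "near M (insert c S \<union> (Q \<union> (R - S))) (card (insert c Q)) (card (insert c Q)) M2" by simp
  moreover have "insert c S \<union> (Q \<union> (R - S)) = insert c Q \<union> R" using S by blast
  ultimately show ?case by metis
qed

lemma gen_disjoint: "matching E M \<Longrightarrow> pairwise disjnt (gen M)"
  using pairwise_subset[OF _ gen_subset] by (auto simp: matching_def)

lemma finite_gen: "matching E M \<Longrightarrow> finite (gen M)"
  using finite_matching finite_subset gen_subset by blast

text \<open>Each generic edge fails as a link for at most \<open>s\<close> vertices outside
  \<open>A\<close>, but a poor vertex misses at least half of the generic edges.\<close>

lemma card_poor:
  assumes M: "matching E M" and g: "m \<le> card (gen M) + d"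
  shows "card (poor M) \<le> 2 * s"
proof -
  let ?g = "card (gen M)" and ?r = "s + 2 * k + 1"
  have g2: "2 * ?r \<le> ?g" using g large_consequences by simp
  have "card (poor M) * (?g - ?r) \<le> ?g * s"
  proof (rule missing_pairs_bound[where Q = "V - A" and R = "\<lambda>e y. insert y (e \<inter> A) \<in> E"])
    show "poor M \<subseteq> V - A" using C_subset by (auto simp: poor_def)
    show "card {y \<in> V - A. insert y (e \<inter> A) \<notin> E} \<le> s" if e: "e \<in> gen M" for e
    proof -
      from e obtain S where "S \<subseteq> A" "card S = k - 1" "e \<inter> A = S" by (rule genE)
      then show ?thesis using card_missing_C by simp
    qed
    fix y assume "y \<in> poor M"
    then have "card (links M y) < ?r" by (simp add: poor_def)
    moreover have "{e \<in> gen M. insert y (e \<inter> A) \<notin> E} = gen M - links M y" by (auto simp: links_def)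
    moreover have "card (gen M - links M y) = ?g - card (links M y)"
      using finite_gen[OF M] by (intro card_Diff_subset) (auto simp: links_def)
    ultimately show "?g - ?r \<le> card {e \<in> gen M. insert y (e \<inter> A) \<notin> E}" by simp
  qed (use finite_gen[OF M] finV in auto)
  moreover have "?g \<le> 2 * (?g - ?r)" "0 < ?g" using g2 by auto
  ultimately show ?thesis by (rule half_cancel)
qed

text \<open>\<open>c\<close> takes a \<open>(k - 1)\<close>-set \<open>X\<close> inside generic edges \<open>T\<close> whose vertices in \<open>C\<close> are not poor;
  the freed vertices of \<open>A\<close>, together with \<open>S\<close>, are then redistributed among the latter.\<close>

lemma augment_good:
  assumes M: "matching E M" and g: "m \<le> card (gen M) + d" and c: "c \<in> C" "c \<notin> \<Union>M"
    and S: "S \<subseteq> A" "card S = k - 1" "S \<inter> \<Union>M = {}"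
  shows "\<exists>M'. near M (insert c S) 1 (2 * k) M'"
proof -
  define G where "G = {e \<in> gen M. e \<inter> poor M = {}}"
  have GM: "G \<subseteq> gen M" "G \<subseteq> M" using gen_subset by (auto simp: G_def)
  have "finite (poor M)" using C_subset finV by (auto simp: poor_def intro: finite_subset[of _ V])
  then have "card (gen M - G) \<le> card (poor M)"
    using pairwise_subset[OF gen_disjoint[OF M], of "gen M - G"]
    by (intro card_le_if_disjoint_hits) (auto simp: G_def)
  moreover have "card (gen M) \<le> card G + card (gen M - G)"
    using diff_card_le_card_Diff[of G "gen M"] finite_subset[OF GM(1) finite_gen[OF M]] by simp
  ultimately have "m \<le> card G + d + 2 * s" using card_poor[OF M g] g by simp
  then have "k * m \<le> k * (card G + d + 2 * s)" by simp
  moreover have "card (V - \<Union>G) = card V - k * card G"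
    using card_Union_matching[OF matching_subset[OF M GM(2)]] matching_Union_subset[OF M] GM(2) finV
    by (metis Sup_subset_mono card_Diff_subset finite_subset order_trans)
  \<comment> \<open>Since \<open>G\<close> has at least \<open>m - d - 2 * s\<close> edges, the
    vertices off its edges are few enough to serve as \<open>Z\<close> in the definition of
    \<open>C\<close>.\<close>
  ultimately have "card (V - \<Union>G) \<le> k * (d + 2 * s + 1)"
    using card_V(2) by (simp add: algebra_simps)
  then obtain X where X: "X \<subseteq> A - (V - \<Union>G)" "card X = k - 1" "insert c X \<in> E"
    using c(1) unfolding C_def by blast
  define T where "T = {e \<in> G. e \<inter> X \<noteq> {}}"
  have T: "T \<subseteq> G" "T \<subseteq> M" using GM by (auto simp: T_def)
  have XA: "X \<subseteq> A" using X by blast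
  have "X \<subseteq> \<Union>G" using X AV by blast
  then have XA: "X \<subseteq> A" "X \<subseteq> \<Union>T" using XA unfolding T_def by blast+
  have finT: "finite T" "finite X"
    using finite_subset[OF T(2) finite_matching[OF M]] finite_subset[OF XA(1) finite_A] .
  have Tdisj: "pairwise disjnt T" using pairwise_subset[of disjnt M T] T(2) M by (simp add: matching_def)
  have "card T \<le> card X" by (rule card_le_if_disjoint_hits[OF Tdisj _ finT(2)]) (simp add: T_def)
  then have cardT: "card T \<le> k - 1" using X(2) by simp
  have cA: "c \<notin> A" using c C_subset by auto
  have part: "card (e - A) = 1" "card (e \<inter> A) = k - 1" if "e \<in> T" for e
    using that T(1) GM(1) by (auto elim!: genE)
  define M1 where "M1 = (M - T) \<union> {insert c X}"
  have new: "\<Union>{insert c X} \<inter> \<Union>(M - T) = {}"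
  proof -
    have "X \<inter> \<Union>(M - T) = {}" using XA(2) T(2) matching_disjoint[OF M] by blast
    then show ?thesis using c(2) by blast
  qed
  note M1 = matching_exchange[OF M T(2) matching_single[OF X(3)] new, folded M1_def]
  define P where "P = (\<Union>e\<in>T. e \<inter> A)"
  define Q where "Q = (\<Union>e\<in>T. e - A)"
  have "card P = (\<Sum>e\<in>T. card (e \<inter> A))"
    unfolding P_def using finT finite_A Tdisj by (intro card_UN_disjoint) (auto simp: pairwise_def disjnt_iff)
  then have cardP: "card P = (k - 1) * card T" using part by simp
  have "card Q = (\<Sum>e\<in>T. card (e - A))"
    unfolding Q_def
  proof (intro card_UN_disjoint ballI impI)
    show "finite (e - A)" if "e \<in> T" for e using that part by (metis card.infinite zero_neq_one)
  qed (use finT Tdisj in \<open>auto simp: pairwise_def disjnt_iff\<close>)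
  then have cardQ: "card Q = card T" using part by simp
  have XP: "X \<subseteq> P" "P \<subseteq> A" "P \<subseteq> \<Union>M" using XA T by (auto simp: P_def)
  have finP: "finite P" "finite S" using finite_subset[OF _ finite_A] XP S by auto
  \<comment> \<open>\<open>X\<close> is used up and \<open>S\<close> is added, both of size
    \<open>k - 1\<close>, so exactly \<open>k - 1\<close> vertices of \<open>A\<close> remain for
    each vertex of \<open>Q\<close>.\<close>
  define R where "R = (P \<union> S) - X"
  have "card (P \<union> S) = (k - 1) * card T + (k - 1)"
    using XP S finP cardP by (subst card_Un_disjoint) auto
  then have cardR: "card R = (k - 1) * card Q"
    unfolding R_def cardQ using XP finT X(2) by (subst card_Diff_subset) auto
  have QC: "Q \<subseteq> C" using T GM by (auto simp: Q_def elim!: genE)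
  have Qfree: "Q \<inter> \<Union>M1 = {}"
  proof -
    have "Q \<inter> \<Union>(M - T) = {}" using T(2) matching_disjoint[OF M] unfolding Q_def by blast
    moreover have "Q \<inter> insert c X = {}" using XA(1) c(2) T(2) unfolding Q_def by blast
    ultimately show ?thesis by (auto simp: M1_def)
  qed
  have Rfree: "R \<inter> \<Union>M1 = {}"
  proof -
    have "P \<inter> \<Union>(M - T) = {}" using T(2) matching_disjoint[OF M] unfolding P_def by blast
    moreover have "S \<inter> \<Union>(M - T) = {}" using S(3) by blast
    moreover have "c \<notin> R" using cA XP S by (auto simp: R_def)
    ultimately show ?thesis by (auto simp: M1_def R_def)
  qed
  have "\<exists>M'. near M1 (Q \<union> R) (card Q) (card Q) M'"
  proof (rule augment_all_linked[OF _ M1(1) QC Qfree _ Rfree cardR])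
    show "finite Q" using QC C_subset finV by (meson finite_Diff finite_subset)
    show "R \<subseteq> A" using XP S by (auto simp: R_def)
    fix b assume b: "b \<in> Q"
    then have "b \<notin> poor M" using T by (auto simp: Q_def G_def)
    then have "s + 2 * k + 1 \<le> card (links M b)" using b QC by (auto simp: poor_def)
    moreover have "card (links M b) \<le> card (links M1 b) + card T"
      using links_change[OF finite_matching[OF M] finite_matching[OF M1(1)], of b] M1(3) by simp
    ultimately show "s + card Q < card (links M1 b)" using cardQ cardT by simp
  qed
  then obtain M' where M': "near M1 (Q \<union> R) (card Q) (card Q) M'" by blast
  have "card (M - M') \<le> card ((M - M1) \<union> (M1 - M'))"
    using finite_matching[OF M] finite_matching[OF M1(1)] by (intro card_mono) auto
  also have "\<dots> \<le> card T + card T"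
    using card_Un_le[of "M - M1" "M1 - M'"] M1(3) M' cardQ by (auto simp: near_def)
  also have "\<dots> \<le> 2 * k" using cardT by simp
  finally have "card (M - M') \<le> 2 * k" .
  moreover have "\<Union>M' \<subseteq> \<Union>M \<union> insert c S"
  proof -
    have "\<Union>M1 \<subseteq> insert c (\<Union>M)" using XP by (auto simp: M1_def)
    moreover have "Q \<union> R \<subseteq> \<Union>M \<union> S" using XP T by (auto simp: Q_def R_def)
    moreover have "\<Union>M' \<subseteq> \<Union>M1 \<union> (Q \<union> R)" using M' by (simp add: near_def)
    ultimately show ?thesis by blast
  qed
  moreover have "card M' = card M + 1" using M' M1(2) cardQ by (simp add: near_def)
  ultimately have "near M (insert c S) 1 (2 * k) M'" using M' by (simp add: near_def)
  then show ?thesis by blast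
qed

section \<open>Absorbing any \<open>k + 1\<close> vertices that include one of
  \<open>C\<close>\<close>

text \<open>Fewer than \<open>k * d + k\<close> vertices lie off the generic edges, and this is
  below \<open>m\<close>, the number of neighbours guaranteed to \<open>S\<close>.\<close>

lemma extend_into_gen:
  assumes M: "matching E M" and g: "m \<le> card (gen M) + d" and S: "S \<subseteq> V" "card S = k - 1"
  obtains e v where "e \<in> gen M" "v \<in> e" "v \<notin> S" "insert v S \<in> E"
proof -
  have GM: "gen M \<subseteq> M" by (rule gen_subset)
  have "card (V - \<Union>(gen M)) = card V - k * card (gen M)"
    using card_Union_matching[OF matching_subset[OF M GM]] matching_Union_subset[OF M] GM finV
    by (metis Sup_subset_mono card_Diff_subset finite_subset order_trans)
  moreover have "k * m \<le> k * (card (gen M) + d)" using g by simp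
  ultimately have "card (V - \<Union>(gen M)) < m"
    using card_V(2) large_consequences(1) by (simp add: algebra_simps)
  also have "m \<le> card (nbr S)" using codegree[OF S] by (simp add: nbr_def)
  finally have "\<not> nbr S \<subseteq> V - \<Union>(gen M)" using finV by (meson card_mono finite_Diff not_le)
  then show thesis using that by (auto simp: nbr_def)
qed

lemma rotate:
  assumes M: "matching E M" and e: "e \<in> M" "v \<in> e" and S: "v \<notin> S" "insert v S \<in> E" "S \<inter> \<Union>M = {}"
  shows "near M S 0 1 ((M - {e}) \<union> {insert v S})" "(e - {v}) \<inter> \<Union>((M - {e}) \<union> {insert v S}) = {}"
proof -
  have "\<Union>{insert v S} \<inter> \<Union>(M - {e}) = {}" using e S(3) matching_disjoint[OF M] by blast
  note ex = matching_exchange[OF M _ matching_single[OF S(2)] this]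
  then show "near M S 0 1 ((M - {e}) \<union> {insert v S})"
    using e by (auto simp: near_def)
  show "(e - {v}) \<inter> \<Union>((M - {e}) \<union> {insert v S}) = {}"
    using e S(3) matching_disjoint[OF M] by blast
qed

text \<open>Rotating \<open>W\<close> into a generic edge \<open>insert b T\<close> covers
  \<open>W\<close> and frees all of the edge but one vertex \<open>v\<close>. If
  \<open>v = b\<close>, all of \<open>T\<close> is free; otherwise \<open>a\<close> replaces
  \<open>v\<close> in \<open>T\<close>. Either way \<open>augment_good\<close> applies to
  \<open>c\<close> and \<open>k - 1\<close> free vertices of \<open>A\<close>.\<close>

lemma augment_mixed:
  assumes M: "matching E M" and g: "m + 1 \<le> card (gen M) + d" and W: "c \<in> C" "a \<in> A" "W \<subseteq> V"
    "card W = k - 1" "a \<notin> W" "c \<notin> W" "insert c (insert a W) \<inter> \<Union>M = {}"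
  shows "\<exists>M'. near M (insert c (insert a W)) 1 (2 * k + 1) M'"
proof -
  have "m \<le> card (gen M) + d" using g by simp
  with M obtain e v where e: "e \<in> gen M" "v \<in> e" "v \<notin> W" "insert v W \<in> E"
    using W extend_into_gen by metis
  from e(1) obtain b T where b: "e \<in> M" "b \<in> C" "b \<notin> A" "T \<subseteq> A" "card T = k - 1" "e = insert b T" "b \<notin> T"
    by (rule genE)
  define M1 where "M1 = (M - {e}) \<union> {insert v W}"
  have Wfree: "W \<inter> \<Union>M = {}" using W by blast
  note r = rotate[OF M b(1) e(2-4) Wfree, folded M1_def]
  have free: "{c, a} \<inter> \<Union>M1 = {}"
  proof -
    have "{c, a} \<inter> \<Union>M = {}" "{c, a} \<inter> W = {}" using W by blast+
    then show ?thesis using r(1) unfolding near_def by blast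
  qed
  define S where "S = (if v = b then T else insert a (T - {v}))"
  have finT: "finite T" using b finite_A finite_subset by blast
  have aT: "a \<notin> T" using W b by blast
  have Sd: "S \<subseteq> insert a (e - {v})" "S \<subseteq> A" using b W by (auto simp: S_def)
  have cardS: "card S = k - 1"
  proof (cases "v = b")
    case False
    then have "v \<in> T" using e(2) b by auto
    then show ?thesis using False finT aT b(5) k3 by (simp add: S_def)
  qed (use b in \<open>simp add: S_def\<close>)
  have "S \<inter> \<Union>M1 = {}" using Sd(1) r(2) free by blast
  moreover have "matching E M1" using r(1) by (simp add: near_def)
  moreover have "m \<le> card (gen M1) + d" using near_gen[OF r(1) M] g by simp
  ultimately obtain M2 where M2: "near M1 (insert c S) 1 (2 * k) M2"
    using augment_good[of M1 c S] W(1) free Sd(2) cardS by blast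
  have "near M (W \<union> insert c S) (0 + 1) (1 + 2 * k) M2" by (rule near_trans[OF r(1) M2 M])
  moreover have "\<Union>M2 \<subseteq> \<Union>M \<union> insert c (insert a W)"
  proof -
    have "\<Union>M2 \<subseteq> \<Union>M \<union> (W \<union> insert c S)" using calculation by (simp add: near_def)
    moreover have "S \<subseteq> \<Union>M \<union> {a}" using Sd(1) b(1) by blast
    ultimately show ?thesis by blast
  qed
  ultimately have "near M (insert c (insert a W)) 1 (2 * k + 1) M2" by (simp add: near_def)
  then show ?thesis by blast
qed

text \<open>If \<open>W\<close> meets \<open>A\<close>, \<open>augment_mixed\<close> applies
  directly. Otherwise \<open>k - 1\<close> vertices of \<open>W - {c}\<close> are first rotated into
  a generic edge, which frees a vertex of \<open>A\<close>.\<close>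

lemma augment_within:
  assumes M: "matching E M" and g: "m + 2 \<le> card (gen M) + d" and W: "c \<in> C" "c \<in> W" "W \<subseteq> V"
    "card W = k + 1" "W \<inter> \<Union>M = {}"
  shows "\<exists>M'. near M W 1 (2 * k + 2) M'"
proof (cases "W \<inter> A = {}")
  case False
  then obtain a where a: "a \<in> W" "a \<in> A" by blast
  have ca: "c \<noteq> a" using W a C_subset by auto
  have finW: "finite W" using W finV finite_subset by blast
  let ?W = "W - {c, a}"
  have eq: "insert c (insert a ?W) = W" using a W by blast
  have "card ?W = k - 1" using a W ca finW by (simp add: card_Diff_subset)
  moreover have "m + 1 \<le> card (gen M) + d" using g by simp
  moreover have "insert c (insert a ?W) \<inter> \<Union>M = {}" unfolding eq by (rule W(5))
  ultimately obtain M' where "near M (insert c (insert a ?W)) 1 (2 * k + 1) M'"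
    using augment_mixed[OF M, of c a ?W] a W by blast
  then have "near M W 1 (2 * k + 2) M'" unfolding eq by (simp add: near_def)
  then show ?thesis by blast
next
  case True
  have finW: "finite W" using W finV finite_subset by blast
  have "k - 1 \<le> card (W - {c})" using W finW by simp
  then obtain S where S: "S \<subseteq> W - {c}" "card S = k - 1" by (meson obtain_subset_with_card_n)
  have "m \<le> card (gen M) + d" "S \<subseteq> V" using g S W by auto
  with M obtain e v where e: "e \<in> gen M" "v \<in> e" "v \<notin> S" "insert v S \<in> E"
    using S(2) extend_into_gen by metis
  from e(1) obtain b T where b: "e \<in> M" "b \<in> C" "b \<notin> A" "T \<subseteq> A" "card T = k - 1" "e = insert b T" "b \<notin> T"
    by (rule genE)
  define M1 where "M1 = (M - {e}) \<union> {insert v S}"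
  have Sfree: "S \<inter> \<Union>M = {}" using W S by blast
  note r = rotate[OF M b(1) e(2-4) Sfree, folded M1_def]
  have finT: "finite T" using b finite_A finite_subset by blast
  \<comment> \<open>\<open>T\<close> has at least two vertices because \<open>k \<ge> 3\<close>, so
    the rotation releases one of them.\<close>
  have "\<not> T \<subseteq> {v}" using card_mono[of "{v}" T] b(5) k3 by auto
  then obtain a where a: "a \<in> T" "a \<noteq> v" by blast
  let ?R = "W - S"
  \<comment> \<open>The one vertex other than \<open>c\<close> left over from \<open>W\<close>,
    together with the \<open>k - 2\<close> released vertices of \<open>e\<close> other than
    \<open>a\<close>.\<close>
  define W' where "W' = (?R - {c}) \<union> (e - {v, a})"
  have eM: "e \<inter> W = {}" using b(1) W by blast
  have card_e: "card e = k" "finite e" using b finT k3 by auto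
  have "card (e - {v, a}) = k - 2" using a e(2) b card_e by (simp add: card_Diff_subset)
  moreover have "card (?R - {c}) = 1"
    using S W finW finite_subset[of S W] k3 by (subst card_Diff_subset card_Diff_singleton | force)+
  ultimately have cardW': "card W' = k - 1"
    unfolding W'_def using eM finW card_e k3 by (subst card_Un_disjoint) auto
  have sub: "insert c (insert a W') \<subseteq> ?R \<union> (e - {v})" using a b S W(2) by (auto simp: W'_def)
  have "?R \<inter> \<Union>M1 = {}"
  proof -
    have "?R \<inter> \<Union>M = {}" using W by blast
    then show ?thesis using r(1) unfolding near_def by blast
  qed
  then have free: "insert c (insert a W') \<inter> \<Union>M1 = {}" using sub r(2) by blast
  have "matching E M1" using r(1) by (simp add: near_def)
  moreover have "m + 1 \<le> card (gen M1) + d" using near_gen[OF r(1) M] g by simp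
  moreover have "a \<in> A" "a \<notin> W'" "c \<notin> W'" "W' \<subseteq> V"
    using a b eM W matching_Union_subset[OF M] by (auto simp: W'_def)
  ultimately obtain M2 where M2: "near M1 (insert c (insert a W')) 1 (2 * k + 1) M2"
    using augment_mixed[of M1 c a W'] W(1) cardW' free by blast
  have "near M (S \<union> insert c (insert a W')) (0 + 1) (1 + (2 * k + 1)) M2"
    by (rule near_trans[OF r(1) M2 M])
  moreover have "\<Union>M2 \<subseteq> \<Union>M \<union> W"
  proof -
    have "\<Union>M2 \<subseteq> \<Union>M \<union> (S \<union> insert c (insert a W'))" using calculation by (simp add: near_def)
    moreover have "insert c (insert a W') \<subseteq> W \<union> \<Union>M" using sub b(1) by blast
    ultimately show ?thesis using S by blast
  qed
  ultimately have "near M W 1 (2 * k + 2) M2" by (simp add: near_def)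
  then show ?thesis by blast
qed

lemma card_uncovered:
  assumes M: "matching E M"
  shows "card (V - \<Union>M) + k * card M = card V"
  using card_Union_matching[OF M] matching_Union_subset[OF M] finV
  by (metis card_Diff_subset card_mono finite_subset le_add_diff_inverse2)

text \<open>Non-divisibility enters here: \<open>k * card M + k \<le> k * m < card V\<close> leaves
  \<open>k + 1\<close> uncovered vertices, one more than an edge needs.\<close>

lemma augment_one:
  assumes M: "matching E M" and g: "m + 2 \<le> card (gen M) + d" and "card M < m"
    and c: "c \<in> C" "c \<notin> \<Union>M"
  shows "\<exists>M'. near M V 1 (2 * k + 2) M'"
proof -
  have "k * (card M + 1) \<le> k * m" using assms by (intro mult_le_mono2) simp
  then have "k + 1 \<le> card (V - \<Union>M)" using card_uncovered[OF M] card_V(1) by (simp add: algebra_simps)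
  moreover have cV: "c \<in> V - \<Union>M" using c C_subset by auto
  ultimately have "k \<le> card (V - \<Union>M - {c})" using finV by simp
  then obtain W where W: "W \<subseteq> V - \<Union>M - {c}" "card W = k" by (meson obtain_subset_with_card_n)
  have "card (insert c W) = k + 1" using W finV by (subst card_insert_disjoint) (auto intro: finite_subset)
  moreover have "insert c W \<subseteq> V" "insert c W \<inter> \<Union>M = {}" using W cV by blast+
  ultimately obtain M' where M': "near M (insert c W) 1 (2 * k + 2) M'"
    using augment_within[OF M g c(1), of "insert c W"] by blast
  then have "near M V 1 (2 * k + 2) M'" using W cV unfolding near_def by blast
  then show ?thesis by blast
qed

text \<open>At least \<open>2 * k + 1\<close> vertices are uncovered, so the first
  \<open>k + 1\<close> can be chosen to avoid \<open>c'\<close>, which stays available for a second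
  augmentation.\<close>

lemma augment_two:
  assumes M: "matching E M" and g: "m + 2 * k + 4 \<le> card (gen M) + d" and "card M + 2 \<le> m"
    and c: "c \<in> C" "c' \<in> C" "c \<noteq> c'" "c \<notin> \<Union>M" "c' \<notin> \<Union>M"
  shows "\<exists>M'. near M V 2 (4 * k + 4) M'"
proof -
  have "k * (card M + 2) \<le> k * m" using assms by (intro mult_le_mono2) simp
  then have "k + k + 1 \<le> card (V - \<Union>M)" using card_uncovered[OF M] card_V(1) by (simp add: algebra_simps)
  moreover have cV: "c \<in> V - \<Union>M" "c' \<in> V - \<Union>M" using c C_subset by auto
  ultimately have "k \<le> card (V - \<Union>M - {c, c'})" using finV c(3) k3 by (simp add: card_Diff_subset)
  then obtain W where W: "W \<subseteq> V - \<Union>M - {c, c'}" "card W = k" by (meson obtain_subset_with_card_n)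
  have "card (insert c W) = k + 1" using W finV by (subst card_insert_disjoint) (auto intro: finite_subset)
  moreover have "insert c W \<subseteq> V" "insert c W \<inter> \<Union>M = {}" using W cV by blast+
  moreover have g2: "m + 2 \<le> card (gen M) + d" using g by simp
  ultimately obtain M1 where M1: "near M (insert c W) 1 (2 * k + 2) M1"
    using augment_within[OF M g2 c(1), of "insert c W"] by blast
  have "c' \<notin> insert c W" using W c(3) by blast
  then have "c' \<notin> \<Union>M1" using M1 c(5) unfolding near_def by blast
  moreover have "matching E M1" "card M1 < m" using M1 assms(3) by (auto simp: near_def)
  moreover have "m + 2 \<le> card (gen M1) + d" using near_gen[OF M1 M] g by simp
  ultimately obtain M2 where M2: "near M1 V 1 (2 * k + 2) M2" using augment_one[of M1 c'] c(2) by blast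
  from near_trans[OF M1 M2 M] have "near M (insert c W \<union> V) 2 (4 * k + 4) M2" by (simp add: near_def)
  moreover have "insert c W \<union> V = V" using W cV by blast
  ultimately show ?thesis by metis
qed

section \<open>Enlarging a matching with many generic edges\<close>

text \<open>The bound \<open>4 * k + 7\<close> is \<open>3\<close> for a preparatory exchange plus
  \<open>2 * (2 * k + 2)\<close> for two augmentations.\<close>

definition enlargeable :: "'a set set \<Rightarrow> bool" where
  "enlargeable M \<longleftrightarrow> (\<exists>M'. matching E M' \<and> card M' = card M + 1 \<and> card (M - M') \<le> 4 * k + 7)"

lemma card_Diff_trans:
  assumes "finite M" "finite M1"
  shows "card (M - M') \<le> card (M - M1) + card (M1 - M')"
proof -
  have "card (M - M') \<le> card ((M - M1) \<union> (M1 - M'))" using assms by (intro card_mono) auto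
  then show ?thesis using card_Un_le[of "M - M1" "M1 - M'"] by linarith
qed

lemma enlargeable_if_one:
  assumes M: "matching E M" and g: "m + 4 * k + 7 \<le> card (gen M) + d" and "card M < m"
    and M1: "matching E M1" "card M1 = card M" "card (M - M1) \<le> 3" and c: "c \<in> C" "c \<notin> \<Union>M1"
  shows "enlargeable M"
proof -
  note fin = finite_matching[OF M] finite_matching[OF M1(1)]
  have "m + 2 \<le> card (gen M1) + d" using card_gen_change[OF fin] g M1(3) by simp
  then obtain M' where M': "near M1 V 1 (2 * k + 2) M'"
    using augment_one[of M1 c] M1 c assms(3) by auto
  have "card (M - M') \<le> 4 * k + 7"
    using card_Diff_trans[OF fin, of M'] M1(3) M' by (simp add: near_def)
  then show ?thesis using M' M1(2) unfolding enlargeable_def near_def by auto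
qed

lemma enlargeable_if_two:
  assumes M: "matching E M" and g: "m + 4 * k + 7 \<le> card (gen M) + d" and "card M < m"
    and M1: "matching E M1" "card M1 + 1 = card M" "card (M - M1) \<le> 3"
    and c: "c \<in> C" "c' \<in> C" "c \<noteq> c'" "c \<notin> \<Union>M1" "c' \<notin> \<Union>M1"
  shows "enlargeable M"
proof -
  note fin = finite_matching[OF M] finite_matching[OF M1(1)]
  have "m + 2 * k + 4 \<le> card (gen M1) + d" using card_gen_change[OF fin] g M1(3) by simp
  then obtain M' where M': "near M1 V 2 (4 * k + 4) M'"
    using augment_two[of M1 c c'] M1 c assms(3) by auto
  have "card (M - M') \<le> 4 * k + 7"
    using card_Diff_trans[OF fin, of M'] M1(3) M' by (simp add: near_def)
  then show ?thesis using M' M1(2) unfolding enlargeable_def near_def by auto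
qed

lemma matching_enlargeable:
  assumes M: "matching E M" and g: "m + 4 * k + 7 \<le> card (gen M) + d" and less: "card M < m"
  shows "enlargeable M"
proof (cases "C \<subseteq> \<Union>M")
  case False
  then obtain c where c: "c \<in> C" "c \<notin> \<Union>M" by blast
  show ?thesis by (rule enlargeable_if_one[OF M g less M _ _ c]) simp_all
next
  case True
  note uniq = matching_disjoint[OF M]
  show ?thesis
  proof (cases "\<exists>f\<in>M. \<exists>c\<in>f \<inter> C. \<exists>c'\<in>f \<inter> C. c \<noteq> c'")
    case True
    then obtain f c c' where f: "f \<in> M" "c \<in> f" "c' \<in> f" "c \<in> C" "c' \<in> C" "c \<noteq> c'" by blast
    have "card (M - {f}) + 1 = card M"
      using f(1) finite_matching[OF M] by (metis Suc_eq_plus1 card_Suc_Diff1)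
    moreover have "card (M - (M - {f})) \<le> 3"
      using f(1) by (simp add: double_diff)
    moreover have "c \<notin> \<Union>(M - {f})" "c' \<notin> \<Union>(M - {f})" using f uniq by blast+
    ultimately show ?thesis
      using enlargeable_if_two[OF M g less matching_subset[OF M], of "M - {f}" c c'] f by blast
  next
    case False
    define M0 where "M0 = {f \<in> M. f \<inter> C = {}}"
    have finM: "finite M" by (rule finite_matching[OF M])
    \<comment> \<open>Every vertex of \<open>C\<close> lies in an edge of \<open>M - M0\<close> and
      no edge holds two of them, so \<open>M - M0\<close> has at least \<open>card C\<close>
      edges.\<close>
    have card_M0: "card M0 + card C < m"
    proof -
      have "C \<subseteq> (\<Union>f\<in>M - M0. f \<inter> C)" using True by (auto simp: M0_def)
      moreover have finC: "finite (f \<inter> C)" for f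
        using C_subset finV by (metis finite_Diff finite_Int finite_subset)
      ultimately have "card C \<le> card (\<Union>f\<in>M - M0. f \<inter> C)"
        using finM by (intro card_mono) auto
      also have "\<dots> \<le> (\<Sum>f\<in>M - M0. card (f \<inter> C))" using finM by (intro card_UN_le) simp
      also have "\<dots> \<le> (\<Sum>f\<in>M - M0. 1)"
        using False finC by (intro sum_mono) (auto simp: card_le_Suc0_iff_eq)
      also have "\<dots> = card M - card M0" using finM by (simp add: card_Diff_subset M0_def)
      finally show ?thesis using card_mono[of M M0] finM less by (simp add: M0_def)
    qed
    \<comment> \<open>The candidates \<open>v\<close> for replacing \<open>e\<close> by an edge on
      \<open>e \<inter> A\<close> and \<open>v\<close>, which avoids \<open>C\<close> and releases
      the vertex of \<open>e\<close> in \<open>C\<close>.\<close>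
    define D where "D e = nbr (e \<inter> A) - C" for e
    have card_D: "card M0 < card (D e)" if "e \<in> gen M" for e
    proof -
      from that obtain T where T: "T \<subseteq> A" "card T = k - 1" "e \<inter> A = T" by (rule genE)
      have "m \<le> card (nbr T)" using codegree[of T] T AV by (simp add: nbr_def)
      moreover have "card (nbr T) - card C \<le> card (D e)"
        unfolding D_def T(3) using C_subset finV by (intro diff_card_le_card_Diff) (auto intro: finite_subset)
      ultimately show ?thesis using card_M0 by simp
    qed
    show ?thesis
    proof (cases "\<exists>e\<in>gen M. \<not> D e \<subseteq> \<Union>M0")
      case True
      then obtain e v where e: "e \<in> gen M" and v: "v \<in> D e" "v \<notin> \<Union>M0" by blast
      from e obtain b T where b: "e \<in> M" "b \<in> C" "b \<notin> A" "T \<subseteq> A" "card T = k - 1" "e = insert b T"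
        "e \<inter> A = T" "b \<notin> T" by (rule genE)
      have vT: "v \<notin> T" "insert v T \<in> E" "v \<notin> C" using v(1) b(7) by (auto simp: D_def nbr_def)
      have ve: "v \<notin> e" using vT b by auto
      note single = matching_single[OF vT(2)]
      show ?thesis
      proof (cases "v \<in> \<Union>M")
        case False
        let ?M1 = "(M - {e}) \<union> {insert v T}"
        have "\<Union>{insert v T} \<inter> \<Union>(M - {e}) = {}" using b(1,6) uniq False by blast
        note ex = matching_exchange[OF M _ single this]
        have "b \<notin> \<Union>?M1" using b(1,2,6,8) vT uniq by blast
        then show ?thesis using enlargeable_if_one[OF M g less ex(1) _ _ b(2)] ex b(1) by simp
      next
        case True
        then obtain f where f: "f \<in> M" "v \<in> f" by blast
        \<comment> \<open>\<open>v\<close> is covered, but not by \<open>M0\<close>. Hence its edge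
          \<open>f\<close> meets \<open>C\<close>, and trading \<open>e\<close> and \<open>f\<close>
          for one new edge frees \<open>b\<close> and \<open>c\<close>.\<close>
        with v have "f \<inter> C \<noteq> {}" by (auto simp: M0_def)
        then obtain c where c: "c \<in> f" "c \<in> C" by blast
        have ef: "e \<noteq> f" using f ve by blast
        let ?M1 = "(M - {e, f}) \<union> {insert v T}"
        have "\<Union>{insert v T} \<inter> \<Union>(M - {e, f}) = {}" using b(1,6) f uniq by blast
        note ex = matching_exchange[OF M _ single this]
        have "b \<notin> \<Union>?M1" using b(1,2,6,8) vT uniq by blast
        moreover have "c \<notin> \<Union>?M1"
        proof -
          have "c \<notin> A" using c C_subset by auto
          then show ?thesis using c f b(4) vT uniq by blast
        qed
        moreover have "b \<noteq> c" using b(1,6) c f ef uniq by blast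
        ultimately show ?thesis
          using enlargeable_if_two[OF M g less ex(1) _ _ b(2) c(2)] ex b(1) f ef by simp
      qed
    next
      case False
      have M0M: "M0 \<subseteq> M" by (auto simp: M0_def)
      \<comment> \<open>\<open>D e\<close> has more than \<open>card M0\<close> vertices, all
        covered by \<open>M0\<close>, so two of them share an edge of \<open>M0\<close>.\<close>
      have "\<forall>e\<in>gen M. \<exists>f\<in>M0. 2 \<le> card (D e \<inter> f)"
      proof (rule ccontr)
        assume "\<not> ?thesis"
        then obtain e where e: "e \<in> gen M" "\<forall>f\<in>M0. card (D e \<inter> f) \<le> 1" by force
        have "D e = (\<Union>f\<in>M0. D e \<inter> f)" using False e(1) by blast
        then have "card (D e) \<le> (\<Sum>f\<in>M0. card (D e \<inter> f))"
          using card_UN_le[of M0 "\<lambda>f. D e \<inter> f"] finite_subset[OF M0M finM] by simp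
        also have "\<dots> \<le> (\<Sum>f\<in>M0. 1)" using e(2) by (intro sum_mono) simp
        finally show False using card_D[OF e(1)] by simp
      qed
      \<comment> \<open>There are more generic edges than edges in \<open>M0\<close>, so two of them can break up the same
        edge of \<open>M0\<close>.\<close>
      then obtain h where h: "\<forall>e\<in>gen M. h e \<in> M0 \<and> 2 \<le> card (D e \<inter> h e)" by metis
      \<comment> \<open>Generic edges meet \<open>C\<close> and so are not in \<open>M0\<close>;
        hence \<open>card M0 < d\<close>, while more than \<open>d\<close> edges are
        generic.\<close>
      have "gen M \<subseteq> M - M0" using gen_subset by (auto simp: M0_def elim!: genE)
      then have "card (gen M) \<le> card M - card M0"
        using finM M0M by (metis card_Diff_subset card_mono finite_Diff finite_subset)
      then have "card M0 < card (gen M)"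
        using g less large_consequences(4) card_mono[OF finM M0M] by simp
      moreover have "card (h ` gen M) \<le> card M0"
        using h finite_subset[OF M0M finM] by (intro card_mono) auto
      ultimately have "\<not> inj_on h (gen M)" by (intro pigeonhole) simp
      then obtain e e' where ee: "e \<in> gen M" "e' \<in> gen M" "e \<noteq> e'" "h e = h e'"
        by (auto simp: inj_on_def)
      define f where "f = h e"
      have f: "f \<in> M" "f \<inter> C = {}" using h ee(1) by (auto simp: f_def M0_def)
      have two: "2 \<le> card (D e \<inter> f)" "2 \<le> card (D e' \<inter> f)" using h ee by (auto simp: f_def)
      then obtain v where v: "v \<in> D e" "v \<in> f" by (metis card.empty disjoint_iff not_numeral_le_zero)
      have "\<not> D e' \<inter> f \<subseteq> {v}" using two(2) card_mono[of "{v}" "D e' \<inter> f"] by auto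
      then obtain w where w: "w \<in> D e'" "w \<in> f" "w \<noteq> v" by blast
      from ee(1) obtain b T where b: "e \<in> M" "b \<in> C" "b \<notin> A" "T \<subseteq> A" "card T = k - 1" "e = insert b T"
        "e \<inter> A = T" "b \<notin> T" by (rule genE)
      from ee(2) obtain b' T' where b': "e' \<in> M" "b' \<in> C" "b' \<notin> A" "T' \<subseteq> A" "card T' = k - 1"
        "e' = insert b' T'" "e' \<inter> A = T'" "b' \<notin> T'" by (rule genE)
      have vw: "insert v T \<in> E" "insert w T' \<in> E" "v \<notin> C" "w \<notin> C"
        using v w b(7) b'(7) by (auto simp: D_def nbr_def)
      have fe: "f \<inter> e = {}" "f \<inter> e' = {}" "e \<inter> e' = {}"
        using f b(1,2,6) b'(1,2,6) ee(3) uniq by blast+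
      have disj: "insert v T \<inter> insert w T' = {}"
        using fe v(2) w(2,3) b(6) b'(6) by blast
      have card3: "card {e, e', f} = 3"
      proof -
        have "f \<noteq> e" "f \<noteq> e'" using fe b(6) b'(6) by auto
        then show ?thesis using ee(3) by simp
      qed
      let ?N = "{insert v T, insert w T'}"
      let ?M1 = "(M - {e, e', f}) \<union> ?N"
      note N = matching_pair[OF vw(1,2) disj]
      have "\<Union>?N \<inter> \<Union>(M - {e, e', f}) = {}"
        using b(1,6) b'(1,6) f(1) v(2) w(2) uniq by blast
      note ex = matching_exchange[OF M _ N(1) this]
      have "b \<notin> \<Union>?N" "b' \<notin> \<Union>?N"
        using b(2,3,8) b'(2,3,4,8) b(4) vw by auto
      moreover have "b \<notin> \<Union>(M - {e, e', f})" "b' \<notin> \<Union>(M - {e, e', f})"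
        using b(1,6) b'(1,6) uniq by blast+
      ultimately have "b \<notin> \<Union>?M1" "b' \<notin> \<Union>?M1" unfolding Union_Un_distrib Un_iff by simp_all
      moreover have "b \<noteq> b'" using fe(3) b(6) b'(6) by auto
      ultimately show ?thesis
        using enlargeable_if_two[OF M g less ex(1) _ _ b(2) b'(2)] ex(2,3) card3 N(2) b(1) b'(1) f(1) by simp
    qed
  qed
qed

section \<open>The initial generic matching and the iteration\<close>

text \<open>With \<open>j = m - s\<close>, the set \<open>A\<close> has more than
  \<open>k * m - m - s = (k - 1) * j + (k - 2) * s\<close> vertices.\<close>

lemma card_A_large:
  assumes "t \<le> m - s"
  shows "(k - 1) * t \<le> card A"
proof -
  have "s \<le> m" using large_consequences(5) by simp
  then obtain j where j: "m = s + j" using le_Suc_ex by blast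
  have "(k - 1) * t \<le> (k - 1) * j" using assms j by simp
  moreover have "(k - 1) * j + j = k * j" using k3 by (metis Suc_diff_1 add.commute mult_Suc not_numeral_le_zero
        zero_less_iff_neq_zero)
  moreover have "2 * s \<le> k * s" using k3 by simp
  moreover have "k * m = k * s + k * j" by (simp add: j distrib_left)
  moreover have "card A + card (V - A) = card V"
    using AV finV by (metis card_Diff_subset card_mono finite_A le_add_diff_inverse)
  ultimately show ?thesis using card_B card_V(1) j by linarith
qed

text \<open>Among \<open>m - s\<close> disjoint \<open>(k - 1)\<close>-subsets of \<open>A\<close>,
  each fails to extend by at most \<open>s\<close> outside vertices. For a vertex not in
  \<open>C\<close>, a small \<open>Z\<close> meets all sets that it extends, so by disjointness
  these are at most half of them; double counting applies.\<close>

lemma card_not_C: "card (V - A - C) \<le> 2 * s"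
proof -
  let ?p = "k * (d + 2 * s + 1)"
  obtain F where F: "card F = m - s" "finite F" "pairwise disjnt F" "\<forall>S\<in>F. S \<subseteq> A \<and> card S = k - 1"
    using disjoint_subsets_exist[OF finite_A, of "k - 1" "m - s"] card_A_large[of "m - s"] k3 by auto
  have "card (V - A - C) * (m - s - ?p) \<le> card F * s"
  proof (rule missing_pairs_bound[where Q = "V - A" and R = "\<lambda>S y. insert y S \<in> E"])
    show "card {y \<in> V - A. insert y S \<notin> E} \<le> s" if "S \<in> F" for S
      using that F(4) card_missing_C by blast
    fix y assume "y \<in> V - A - C"
    then obtain Z where Z: "Z \<subseteq> V" "card Z \<le> ?p"
      "\<forall>X. X \<subseteq> A - Z \<and> card X = k - 1 \<longrightarrow> insert y X \<notin> E"
      unfolding C_def by blast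
    let ?H = "{S \<in> F. insert y S \<in> E}"
    have "card ?H \<le> card Z"
    proof (rule card_le_if_disjoint_hits)
      show "pairwise disjnt ?H" using F(3) by (rule pairwise_subset) blast
      show "S \<inter> Z \<noteq> {}" if "S \<in> ?H" for S using that Z(3) F(4) by blast
      show "finite Z" using Z(1) finV by (rule finite_subset)
    qed
    moreover have "{S \<in> F. insert y S \<notin> E} = F - ?H" by blast
    moreover have "card (F - ?H) = card F - card ?H" using F(2) by (intro card_Diff_subset) auto
    ultimately show "m - s - ?p \<le> card {S \<in> F. insert y S \<notin> E}" using F(1) Z(2) by simp
  qed (use F finV in auto)
  moreover have "0 < ?p" using k3 by simp
  then have "m - s \<le> 2 * (m - s - ?p)" "0 < m - s" using large_consequences(2) by linarith+
  ultimately show ?thesis unfolding F(1) by (rule half_cancel)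
qed

text \<open>Each of \<open>m - 2 * s\<close> disjoint \<open>(k - 1)\<close>-subsets of
  \<open>A\<close> has at least \<open>m\<close> neighbours, at most \<open>2 * s\<close> of them
  outside \<open>C\<close>, so distinct neighbours in \<open>C\<close> can be chosen
  greedily.\<close>

lemma initial_matching:
  obtains M where "matching E M" "card M = m - 2 * s" "card (gen M) = m - 2 * s"
proof -
  let ?t = "m - 2 * s"
  have "(k - 1) * ?t \<le> card A" by (rule card_A_large) simp
  then obtain F where F: "card F = ?t" "finite F" "pairwise disjnt F" "\<forall>S\<in>F. S \<subseteq> A \<and> card S = k - 1"
    using disjoint_subsets_exist[OF finite_A, of "k - 1" ?t] k3 by auto
  have "\<exists>f. inj_on f F \<and> (\<forall>S\<in>F. f S \<in> nbr S \<inter> C)"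
  proof (rule distinct_representatives_greedy[OF F(2)])
    fix S assume "S \<in> F"
    then have S: "S \<subseteq> A" "card S = k - 1" using F(4) by auto
    have "nbr S \<subseteq> (nbr S \<inter> C) \<union> (V - A - C)" using S indep by (auto simp: nbr_def)
    then have "card (nbr S) \<le> card ((nbr S \<inter> C) \<union> (V - A - C))"
      using finV by (intro card_mono) (auto simp: nbr_def)
    also have "\<dots> \<le> card (nbr S \<inter> C) + card (V - A - C)" by (rule card_Un_le)
    finally have "card (nbr S) \<le> card (nbr S \<inter> C) + 2 * s" using card_not_C by linarith
    moreover have "m \<le> card (nbr S)" using codegree[of S] S AV by (simp add: nbr_def)
    ultimately show "card F \<le> card (nbr S \<inter> C)" using F(1) by simp
  qed
  then obtain f where f: "inj_on f F" "\<forall>S\<in>F. f S \<in> nbr S \<inter> C" by blast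
  have fA: "f S \<notin> A" if "S \<in> F" for S using that f(2) C_subset by blast
  define M where "M = (\<lambda>S. insert (f S) S) ` F"
  have ident: "insert (f S) S \<inter> A = S" if "S \<in> F" for S using that fA F(4) by auto
  have "inj_on (\<lambda>S. insert (f S) S) F" by (rule inj_onI) (metis ident)
  then have card_M: "card M = ?t" using F(1) by (simp add: M_def card_image)
  have "disjnt (insert (f S) S) (insert (f T) T)" if "S \<in> F" "T \<in> F" "S \<noteq> T" for S T
  proof -
    have "f S \<noteq> f T" using f(1) that by (auto simp: inj_on_def)
    moreover have "disjnt S T" using F(3) that by (auto simp: pairwise_def)
    ultimately show ?thesis using fA that F(4) by (auto simp: disjnt_iff)
  qed
  then have "pairwise disjnt M" by (auto simp: M_def pairwise_def)
  moreover have "M \<subseteq> E" using f(2) by (auto simp: M_def nbr_def)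
  ultimately have "matching E M" by (simp add: matching_def)
  moreover have "M \<subseteq> gen M"
  proof
    fix e assume e: "e \<in> M"
    then obtain S where "S \<in> F" "e = insert (f S) S" by (auto simp: M_def)
    then show "e \<in> gen M" using e f(2) F(4) unfolding gen_def by blast
  qed
  then have "gen M = M" using gen_subset by blast
  ultimately show thesis using that card_M by simp
qed

text \<open>\<open>d\<close> is the initial deficit \<open>2 * s\<close> of generic edges plus
  \<open>2 * s\<close> rounds that each lose at most \<open>4 * k + 7\<close> of them.\<close>

lemma near_perfect_matching:
  assumes d: "d = 2 * s * (4 * k + 8)"
  obtains M where "matching E M" "card M = m"
proof -
  let ?K = "4 * k + 7"
  have s: "2 * s \<le> m" by (rule large_consequences)
  have "\<exists>M. matching E M \<and> card M = m - 2 * s + i \<and> m \<le> card (gen M) + 2 * s + ?K * i"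
    if "i \<le> 2 * s" for i
    using that
  proof (induction i)
    case 0
    obtain M where "matching E M" "card M = m - 2 * s" "card (gen M) = m - 2 * s"
      by (rule initial_matching)
    then show ?case by (intro exI[of _ M]) simp
  next
    case (Suc i)
    then obtain M where M: "matching E M" "card M = m - 2 * s + i" "m \<le> card (gen M) + 2 * s + ?K * i"
      by auto
    have "?K * (i + 1) \<le> ?K * (2 * s)" using Suc.prems by (intro mult_le_mono2) simp
    then have "m + 4 * k + 7 \<le> card (gen M) + d" using M(3) by (simp add: d algebra_simps)
    moreover have "card M < m" using M(2) Suc.prems s by simp
    ultimately have "enlargeable M" using matching_enlargeable[OF M(1)] by simp
    then obtain M' where M': "matching E M'" "card M' = card M + 1" "card (M - M') \<le> ?K"
      by (auto simp: enlargeable_def)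
    have "card (gen M) \<le> card (gen M') + ?K"
      using card_gen_change[OF finite_matching[OF M(1)] finite_matching[OF M'(1)]] M'(3) by simp
    then have "m \<le> card (gen M') + 2 * s + ?K * Suc i" using M(3) by simp
    then show ?case using M' M(2) by (intro exI[of _ M']) simp
  qed
  from this[of "2 * s"] s show thesis using that by auto
qed

end

section \<open>Choice of constants and reduction to the extremal setting\<close>

lemma codegree_le_card_nbr:
  assumes H: "uniform_hypergraph k V E" and k: "0 < k" and S: "S \<subseteq> V" "card S = k - 1"
  shows "min_degree (k - 1) V E \<le> card {v \<in> V. v \<notin> S \<and> insert v S \<in> E}"
proof -
  have fin: "finite V" "finite S" using H S(1) by (auto simp: uniform_hypergraph_def intro: finite_subset)
  have "min_degree (k - 1) V E \<le> set_degree E S"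
    unfolding min_degree_def using fin S by (intro Min_le) auto
  also have "{e \<in> E. S \<subseteq> e} \<subseteq> (\<lambda>v. insert v S) ` {v \<in> V. v \<notin> S \<and> insert v S \<in> E}"
  proof
    fix e assume e: "e \<in> {e \<in> E. S \<subseteq> e}"
    then have eV: "e \<subseteq> V" "card e = k" using H by (auto simp: uniform_hypergraph_def)
    then have "card (e - S) = 1" using e S fin k by (simp add: card_Diff_subset)
    then obtain v where "e - S = {v}" by (rule card_1_singletonE)
    then have "e = insert v S" "v \<notin> S" "v \<in> V" using e eV by auto
    then show "e \<in> (\<lambda>v. insert v S) ` {v \<in> V. v \<notin> S \<and> insert v S \<in> E}" using e by auto
  qed
  then have "set_degree E S \<le> card {v \<in> V. v \<notin> S \<and> insert v S \<in> E}"
    unfolding set_degree_def using fin by (intro surj_card_le) auto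
  finally show ?thesis .
qed

text \<open>\<open>a\<close> stands for \<open>card A\<close>. With \<open>m = n div k\<close>,
  extremality gives \<open>n - a - m \<le> 1 + \<epsilon> * n\<close>. By the choice of
  \<open>\<epsilon>\<close>, \<open>D * (2 + \<epsilon> * n) = 2 * D + n / (2 * k)\<close>, which is
  at most \<open>n / k - 1 < m\<close> since the bound on \<open>n\<close> means
  \<open>n / k \<ge> 4 * D + 2\<close>.\<close>

lemma extremal_complement_bounds:
  fixes k n a :: nat and \<epsilon> :: real
  defines "D \<equiv> 6 * k * (8 * k + 18)"
  assumes k: "3 \<le> k" and eps: "\<epsilon> = 1 / (2 * real k * real D)" and n: "2 * k * (2 * D + 1) \<le> n"
    and a: "a \<le> n" "(1 - \<epsilon>) * ((real k - 1) / real k) * real n \<le> real a"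
  shows "k - 1 \<le> a" "D * (n - a - n div k + 1) \<le> n div k"
proof -
  have D1: "1 \<le> D" using k by (simp add: D_def)
  have kD: "0 < 2 * real k * real D" using k D1 by simp
  have "1 \<le> real k * real D" using k D1 by (metis One_nat_def Suc_leI mult_pos_pos numeral_le_iff of_nat_1 of_nat_le_iff of_nat_mult
        less_le_trans zero_less_numeral zero_less_one)
  then have eps_half: "\<epsilon> \<le> 1 / 2" "0 \<le> \<epsilon>" unfolding eps by (auto simp: field_simps)
  have nR: "2 * real k * (2 * real D + 1) \<le> real n"
    using n by (metis (mono_tags) of_nat_1 of_nat_add of_nat_le_iff of_nat_mult of_nat_numeral)
  have nk: "4 * real D + 2 \<le> real n / real k" using nR k by (simp add: field_simps)
  have "real k - 1 \<le> (1 / 2) * ((real k - 1) * (real n / real k))"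
    using mult_left_mono[OF nk, of "real k - 1"] mult_left_mono[of 2 "4 * real D + 2" "real k - 1"] k by simp
  also have "\<dots> \<le> (1 - \<epsilon>) * ((real k - 1) * (real n / real k))"
    using eps_half k by (intro mult_right_mono) auto
  also have "\<dots> \<le> real a" using a(2) by (simp add: algebra_simps)
  finally show "k - 1 \<le> a" using k by linarith
  let ?m = "n div k"
  have "n < k * ?m + k" using k by (metis add.commute add_less_cancel_left mod_less_divisor mult_div_mod_eq
        less_le_trans zero_less_numeral)
  then have "real n < real k * real ?m + real k"
    by (metis of_nat_add of_nat_less_iff of_nat_mult)
  then have m: "real n / real k - 1 < real ?m" using k by (simp add: field_simps)
  have "real n - real n / real k - \<epsilon> * real n \<le> (1 - \<epsilon>) * ((real k - 1) / real k) * real n"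
  proof -
    have "(1 - \<epsilon>) * ((real k - 1) / real k) * real n
        = real n - real n / real k - \<epsilon> * real n + \<epsilon> * real n / real k"
      using k by (simp add: field_simps)
    then show ?thesis using eps_half(2) by simp
  qed
  with a(2) m have b: "real n - real a - real ?m \<le> 1 + \<epsilon> * real n" by linarith
  have "real (n - a - ?m) \<le> 1 + \<epsilon> * real n"
    using b a(1) eps_half(2) by (cases "?m \<le> n - a") (auto simp: of_nat_diff)
  then have "real D * (real (n - a - ?m) + 1) \<le> real D * (2 + \<epsilon> * real n)"
    by (intro mult_left_mono) auto
  also have "\<dots> = 2 * real D + (real n / real k) / 2"
    using D1 k by (simp add: eps field_simps)
  also have "\<dots> \<le> real n / real k - 1"
  proof -
    have "2 * y + q / 2 \<le> q - 1" if "4 * y + 2 \<le> q" for y q :: real using that by linarith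
    then show ?thesis using nk .
  qed
  finally have "real (D * (n - a - ?m + 1)) \<le> real ?m"
    unfolding of_nat_mult of_nat_add of_nat_1 using m by linarith
  then show "D * (n - a - ?m + 1) \<le> ?m" by linarith
qed

theorem theorem1p5:
  fixes k :: nat
  assumes "k \<ge> 3"
  shows "\<exists>(\<epsilon>::real) (n1::nat). \<epsilon> > 0 \<and>
    (\<forall>(n::nat) (V :: 'a set) (E :: 'a set set).
       n \<ge> n1 \<longrightarrow> \<not> k dvd n \<longrightarrow>
       uniform_hypergraph k V E \<longrightarrow> card V = n \<longrightarrow>
       min_degree (k - 1) V E \<ge> n div k \<longrightarrow>
       extremal k \<epsilon> V E \<longrightarrow>
       (\<exists>M. matching E M \<and> card M = n div k))"
proof -
  \<comment> \<open>With \<open>d = 2 * s * (4 * k + 8)\<close> one has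
    \<open>d + 2 * s = (8 * k + 18) * s\<close>, so \<open>D * (s + 1) \<le> n div k\<close> yields
    the assumption \<open>large\<close>.\<close>
  define D where "D = 6 * k * (8 * k + 18)"
  define \<epsilon> where "\<epsilon> = 1 / (2 * real k * real D)"
  have "\<exists>M. matching E M \<and> card M = n div k"
    if n: "n \<ge> 2 * k * (2 * D + 1)" and ndvd: "\<not> k dvd n" and H: "uniform_hypergraph k V E"
      and V: "card V = n" and deg: "min_degree (k - 1) V E \<ge> n div k" and ext: "extremal k \<epsilon> V E"
    for n and V :: "'a set" and E
  proof -
    let ?m = "n div k"
    obtain A where A: "A \<subseteq> V" "\<forall>e\<in>E. \<not> e \<subseteq> A"
      "(1 - \<epsilon>) * ((real k - 1) / real k) * real n \<le> real (card A)"
      using ext V by (auto simp: extremal_def independent_set_def)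
    have finV: "finite V" using H by (simp add: uniform_hypergraph_def)
    have edge: "e \<subseteq> V \<and> card e = k" if "e \<in> E" for e using H that by (auto simp: uniform_hypergraph_def)
    have "card A \<le> n" using A(1) V finV card_mono by blast
    note bounds = extremal_complement_bounds[OF assms \<epsilon>_def[unfolded D_def] n[unfolded D_def] this A(3),
        folded D_def]
    have cod: "?m \<le> card {v \<in> V. v \<notin> S \<and> insert v S \<in> E}" if "S \<subseteq> V" "card S = k - 1" for S
      using codegree_le_card_nbr[OF H _ that] deg assms by simp
    have card_B: "card (V - A) = n - card A" using A(1) V finV by (metis card_Diff_subset finite_subset)
    \<comment> \<open>A \<open>(k - 1)\<close>-set inside \<open>A\<close> has all its neighbours,
      at least \<open>n div k\<close>, outside \<open>A\<close>; hence the subtraction defining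
      \<open>s\<close> is exact.\<close>
    obtain S where S: "S \<subseteq> A" "card S = k - 1" using bounds(1) by (meson obtain_subset_with_card_n)
    have "?m \<le> card {v \<in> V. v \<notin> S \<and> insert v S \<in> E}" using cod S A(1) by blast
    also have "\<dots> \<le> card (V - A)" using S A(2) finV by (intro card_mono) auto
    finally have mB: "?m \<le> card (V - A)" .
    define s where "s = card (V - A) - ?m"
    define d where "d = 2 * s * (4 * k + 8)"
    have "n mod k \<noteq> 0" using ndvd by (simp add: dvd_eq_mod_eq_0)
    then have n_bounds: "k * ?m < n" "n < k * ?m + k"
      using mult_div_mod_eq[of k n] mod_less_divisor[of k n] assms by linarith+
    have "d + 2 * s + 1 \<le> (8 * k + 18) * (s + 1)" by (simp add: d_def algebra_simps)
    then have "6 * k * (d + 2 * s + 1) \<le> 6 * k * ((8 * k + 18) * (s + 1))" by (rule mult_le_mono2)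
    also have "\<dots> = D * (s + 1)" by (simp only: D_def mult.assoc)
    also have "\<dots> \<le> ?m" using bounds(2) card_B by (simp add: s_def)
    finally have large: "6 * k * (d + 2 * s + 1) \<le> ?m" .
    interpret extremal_hypergraph k ?m s d V A E
    proof
      show "card (V - A) = ?m + s" using mB by (simp add: s_def)
      show "\<not> e \<subseteq> A" if "e \<in> E" for e using A(2) that by blast
      show "k * ?m < card V" "card V < k * ?m + k" using n_bounds V by simp_all
    qed (fact assms finV edge A(1) cod large)+
    show ?thesis using near_perfect_matching[OF d_def] by metis
  qed
  moreover have "\<epsilon> > 0" using assms by (simp add: \<epsilon>_def D_def)
  ultimately show ?thesis by blast
qed

end
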